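(* Let $\mathcal{A}$ be an independence algebra with universe $A$ and let $\mathcal{B}$ be a non-empty subalgebra of $\mathcal{A}$ with universe $B$. Assume $\mathcal{B}\neq\mathcal{A}$ and that either $\dim B\geq 2$, or $\langle\emptyset\rangle\neq\emptyset$ and $\dim B=1$. Let $T(\mathcal{A},\mathcal{B})$ be the semigroup of all endomorphisms of $\mathcal{A}$ whose image is contained in $B$. If $\alpha,\beta\in T(\mathcal{A},\mathcal{B})$, then $\alpha=\beta\mu$ for some $\mu\in T(\mathcal{A},\mathcal{B})$ if and only if $\ker\beta\subseteq\ker\alpha$. Consequently, $\alpha\,\mathcal{R}\,\beta$ in $T(\mathcal{A},\mathcal{B})$ if and only if $\ker\alpha=\ker\beta$.
   Context: An algebra $\mathcal{A}=\langle A;F\rangle$ has a non-empty universe $A$ and a set $F$ of finitary operations. For $X\subseteq A$, $\langle X\rangle$ is the set of all $t(a_1,\dots,a_n)$ with $t$ a term operation and $a_i\in X$ (the subalgebra generated by $X$); $\langle\emptyset\rangle$ is the set of constants, i.e. values of nullary term operations (possibly empty). $X$ is independent if $x\notin\langle X\setminus\{x\}\rangle$ for all $x\in X$; a basis of a subalgebra is an independent generating set. Exchange property (EP): for all $X\subseteq A$ and $a,b\in A$, if $b\in\langle X\cup\{a\}\rangle$ and $b\notin\langle X\rangle$ then $a\in\langle X\cup\{b\}\rangle$. Under (EP) every subalgebra has a basis, all its bases have the same cardinality (its dimension, $\dim$), and independent sets extend to bases. Free basis property (F): every map from a basis of $\mathcal{A}$ to $A$ extends to an endomorphism of $\mathcal{A}$.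 An independence algebra is an algebra satisfying (EP) and (F). Dimensions may be finite or infinite. Maps are written on the right and composed left to right. $\ker\alpha=\{(x,y)\in A\times A: x\alpha=y\alpha\}$. $\mathcal{R}$ is Green's relation: $a\,\mathcal{R}\,b$ in a semigroup $S$ iff $aS^1=bS^1$. *)

theory Defs
  imports Main "HOL-Library.FuncSet"
begin

unbundle cardinal_syntax

text \<open>An algebra is given by a carrier \<open>A\<close> and a set \<open>F\<close> of pairs \<open>(n, f)\<close>, where \<open>f\<close> is an
  operation of arity \<open>n\<close>; only the values of \<open>f\<close> on lists of length \<open>n\<close> over \<open>A\<close> matter.
  A pair \<open>(0, f)\<close> is a nullary operation with value \<open>f []\<close>.\<close>

type_synonym 'a ops = "(nat \<times> ('a list \<Rightarrow> 'a)) set"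

definition algebra :: "'a set \<Rightarrow> 'a ops \<Rightarrow> bool" where
  "algebra A F \<longleftrightarrow> A \<noteq> {} \<and>
     (\<forall>(n, f) \<in> F. \<forall>xs. length xs = n \<and> set xs \<subseteq> A \<longrightarrow> f xs \<in> A)"

definition subalgebra :: "'a set \<Rightarrow> 'a ops \<Rightarrow> 'a set \<Rightarrow> bool" where
  "subalgebra A F B \<longleftrightarrow> B \<subseteq> A \<and>
     (\<forall>(n, f) \<in> F. \<forall>xs. length xs = n \<and> set xs \<subseteq> B \<longrightarrow> f xs \<in> B)"

inductive term_op :: "'a ops \<Rightarrow> nat \<Rightarrow> ('a list \<Rightarrow> 'a) \<Rightarrow> bool" for F :: "'a ops" and n :: nat where
  proj: "i < n \<Longrightarrow> term_op F n (\<lambda>xs. xs ! i)"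
| app: "(k, f) \<in> F \<Longrightarrow> length ts = k \<Longrightarrow> (\<And>t. t \<in> set ts \<Longrightarrow> term_op F n t)
    \<Longrightarrow> term_op F n (\<lambda>xs. f (map (\<lambda>t. t xs) ts))"

text \<open>The case \<open>n = 0\<close> is included, so \<open>gen F {}\<close> is the set of values of nullary term operations.\<close>

definition gen :: "'a ops \<Rightarrow> 'a set \<Rightarrow> 'a set" where
  "gen F X = {t xs | n t xs. term_op F n t \<and> length xs = n \<and> set xs \<subseteq> X}"

definition indep :: "'a ops \<Rightarrow> 'a set \<Rightarrow> bool" where
  "indep F X \<longleftrightarrow> (\<forall>x\<in>X. x \<notin> gen F (X - {x}))"

definition basis_of :: "'a ops \<Rightarrow> 'a set \<Rightarrow> 'a set \<Rightarrow> bool" where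
  "basis_of F X B \<longleftrightarrow> indep F X \<and> gen F X = B"

text \<open>The dimension is a cardinal in the sense of the BNF cardinal library. Under the exchange
  property a basis exists and the choice of basis is irrelevant up to \<open>=o\<close>.\<close>

definition alg_dim :: "'a ops \<Rightarrow> 'a set \<Rightarrow> 'a rel" where
  "alg_dim F B = |SOME X. basis_of F X B|"

definition exchange_property :: "'a set \<Rightarrow> 'a ops \<Rightarrow> bool" where
  "exchange_property A F \<longleftrightarrow> (\<forall>X a b. X \<subseteq> A \<and> a \<in> A \<and> b \<in> A \<and>
     b \<in> gen F (X \<union> {a}) \<and> b \<notin> gen F X \<longrightarrow> a \<in> gen F (X \<union> {b}))"

text \<open>Endomorphisms are extensional functions (\<open>undefined\<close> outside \<open>A\<close>), so that equality of
  HOL functions is equality of maps on \<open>A\<close>.\<close>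

definition endos :: "'a set \<Rightarrow> 'a ops \<Rightarrow> ('a \<Rightarrow> 'a) set" where
  "endos A F = {\<alpha> \<in> A \<rightarrow>\<^sub>E A. \<forall>(n, f) \<in> F. \<forall>xs. length xs = n \<and> set xs \<subseteq> A
     \<longrightarrow> \<alpha> (f xs) = f (map \<alpha> xs)}"

definition free_basis_property :: "'a set \<Rightarrow> 'a ops \<Rightarrow> bool" where
  "free_basis_property A F \<longleftrightarrow> (\<forall>X g. basis_of F X A \<and> g \<in> X \<rightarrow> A
     \<longrightarrow> (\<exists>\<alpha>\<in>endos A F. \<forall>x\<in>X. \<alpha> x = g x))"

definition independence_algebra :: "'a set \<Rightarrow> 'a ops \<Rightarrow> bool" where
  "independence_algebra A F \<longleftrightarrow>
     algebra A F \<and> exchange_property A F \<and> free_basis_property A F"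

definition endos_into :: "'a set \<Rightarrow> 'a ops \<Rightarrow> 'a set \<Rightarrow> ('a \<Rightarrow> 'a) set" where
  "endos_into A F B = {\<alpha> \<in> endos A F. \<alpha> ` A \<subseteq> B}"

text \<open>Maps act on the right: \<open>rcomp A \<alpha> \<beta>\<close> applies \<open>\<alpha>\<close> first, then \<open>\<beta>\<close>.\<close>

definition rcomp :: "'a set \<Rightarrow> ('a \<Rightarrow> 'a) \<Rightarrow> ('a \<Rightarrow> 'a) \<Rightarrow> 'a \<Rightarrow> 'a" where
  "rcomp A \<alpha> \<beta> = compose A \<beta> \<alpha>"

definition map_ker :: "'a set \<Rightarrow> ('a \<Rightarrow> 'a) \<Rightarrow> 'a rel" where
  "map_ker A \<alpha> = {(x, y) \<in> A \<times> A. \<alpha> x = \<alpha> y}"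

text \<open>In a semigroup \<open>S\<close> the principal right ideal \<open>a S\<^sup>1\<close> equals \<open>{a} \<union> a S\<close>, whether or not \<open>S\<close>
  already has an identity.\<close>

definition principal_right_ideal :: "'s set \<Rightarrow> ('s \<Rightarrow> 's \<Rightarrow> 's) \<Rightarrow> 's \<Rightarrow> 's set" where
  "principal_right_ideal S m a = {a} \<union> m a ` S"

definition green_R :: "'s set \<Rightarrow> ('s \<Rightarrow> 's \<Rightarrow> 's) \<Rightarrow> 's \<Rightarrow> 's \<Rightarrow> bool" where
  "green_R S m a b \<longleftrightarrow> a \<in> S \<and> b \<in> S \<and>
     principal_right_ideal S m a = principal_right_ideal S m b"

end

(* Choose a basis of the image of \<beta>, extend it to a basis of A, and send each basis element y
   of the image to the \<alpha>-value of a \<beta>-preimage of y, the others to a fixed element of B.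
   By freeness this extends to an endomorphism \<mu>, and ker \<beta> \<subseteq> ker \<alpha> makes the choice of
   preimages irrelevant, so \<beta>\<mu> = \<alpha>. *)

theory Submission
  imports Defs
begin

section \<open>Term operations and generated subsets\<close>

text \<open>Substituting variables along \<sigma> turns projections into projections and passes
  through applications. This brings terms of different arities to a common one.\<close>

lemma term_op_reindex:
  assumes "term_op F n t" and "\<And>i. i < n \<Longrightarrow> \<sigma> i < m"
  shows "term_op F m (\<lambda>xs. t (map (\<lambda>i. xs ! \<sigma> i) [0..<n]))"
  using assms(1)
proof induction
  case (proj i)
  have "term_op F m (\<lambda>xs. xs ! \<sigma> i)"
    using assms(2)[OF proj] by (rule term_op.proj)
  then show ?case using proj by simp
next
  case (app k f ts)
  let ?r = "\<lambda>t xs. t (map (\<lambda>i. xs ! \<sigma> i) [0..<n])"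
  have "term_op F m (\<lambda>xs. f (map (\<lambda>t. t xs) (map ?r ts)))"
    using app by (intro term_op.app[where k = k]) auto
  then show ?case by (simp add: comp_def)
qed

lemma gen_base: "X \<subseteq> gen F X"
proof
  fix x assume "x \<in> X"
  moreover have "term_op F 1 (\<lambda>xs. xs ! 0)" by (rule term_op.proj) simp
  ultimately show "x \<in> gen F X"
    unfolding gen_def by (auto intro!: exI[of _ 1] exI[of _ "\<lambda>xs. xs ! 0"] exI[of _ "[x]"])
qed

lemma gen_mono: "X \<subseteq> Y \<Longrightarrow> gen F X \<subseteq> gen F Y"
  unfolding gen_def by blast

lemma gen_memI: "term_op F n t \<Longrightarrow> length xs = n \<Longrightarrow> set xs \<subseteq> X \<Longrightarrow> t xs \<in> gen F X"
  unfolding gen_def by blast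

text \<open>A term reads only the finitely many entries of its argument list, so those entries
  already generate the value.\<close>

lemma gen_finite_subset:
  assumes "x \<in> gen F X"
  obtains Y where "finite Y" "Y \<subseteq> X" "x \<in> gen F Y"
proof -
  from assms obtain n t xs where "x = t xs" "term_op F n t" "length xs = n" "set xs \<subseteq> X"
    unfolding gen_def by blast
  then show thesis
    using that[of "set xs"] unfolding gen_def by blast
qed

text \<open>Each element of \<open>gen F X\<close> comes with its own term and its own arguments,
  but \<open>app\<close> combines only terms of equal arity. Concatenating the argument lists and
  reindexing makes all terms read one list.\<close>

lemma gen_common_arguments:
  assumes "set xs \<subseteq> gen F X"
  obtains zs ts where "set zs \<subseteq> X" "\<And>t. t \<in> set ts \<Longrightarrow> term_op F (length zs) t"
    "map (\<lambda>t. t zs) ts = xs"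
  using assms
proof (induction xs arbitrary: thesis)
  case Nil
  show ?case by (rule Nil(1)[of "[]" "[]"]) auto
next
  case (Cons x xs)
  obtain zs ts where zs: "set zs \<subseteq> X" and ts: "\<And>t. t \<in> set ts \<Longrightarrow> term_op F (length zs) t"
    and map: "map (\<lambda>t. t zs) ts = xs"
    using Cons.IH Cons.prems(2) by auto
  obtain t ys where x: "x = t ys" and t: "term_op F (length ys) t" and ys: "set ys \<subseteq> X"
    using Cons.prems(2) unfolding gen_def by auto
  \<comment> \<open>In \<open>ys @ zs\<close> the new term reads the first block, and the terms from
    the induction hypothesis read the second, hence the shift by \<open>length ys\<close>.\<close>
  define left where
    "left = (\<lambda>s :: 'a list \<Rightarrow> 'a. \<lambda>ws. s (map (\<lambda>i. ws ! i) [0..<length ys]))"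
  define right where
    "right = (\<lambda>s :: 'a list \<Rightarrow> 'a. \<lambda>ws. s (map (\<lambda>i. ws ! (length ys + i)) [0..<length zs]))"
  have l: "map (\<lambda>i. (ys @ zs) ! i) [0..<length ys] = ys"
    by (rule nth_equalityI) (auto simp: nth_append)
  have r: "map (\<lambda>i. (ys @ zs) ! (length ys + i)) [0..<length zs] = zs"
    by (rule nth_equalityI) (auto simp: nth_append)
  show ?case
  proof (rule Cons.prems(1)[of "ys @ zs" "left t # map right ts"])
    show "set (ys @ zs) \<subseteq> X" using ys zs by simp
    show "term_op F (length (ys @ zs)) s" if "s \<in> set (left t # map right ts)" for s
      using that t ts unfolding left_def right_def by (auto intro!: term_op_reindex)
    show "map (\<lambda>s. s (ys @ zs)) (left t # map right ts) = x # xs"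
      unfolding left_def right_def
      using x map l r by (simp add: comp_def)
  qed
qed

lemma gen_closed:
  assumes "(n, f) \<in> F" "length xs = n" "set xs \<subseteq> gen F X"
  shows "f xs \<in> gen F X"
proof -
  obtain zs ts where zs: "set zs \<subseteq> X" and ts: "\<And>t. t \<in> set ts \<Longrightarrow> term_op F (length zs) t"
    and map: "map (\<lambda>t. t zs) ts = xs"
    using gen_common_arguments[OF assms(3)] by blast
  have "term_op F (length zs) (\<lambda>ws. f (map (\<lambda>t. t ws) ts))"
    using assms(1,2) ts map by (intro term_op.app[where k = n]) auto
  from gen_memI[OF this refl zs] show ?thesis using map by simp
qed

text \<open>Induction over the term, recast as induction over its value. The closure case also
  records that the arguments are generated by X, which later places them in A.\<close>

lemma gen_induct [consumes 1, case_names base closed]: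
  assumes "x \<in> gen F X"
    and base: "\<And>x. x \<in> X \<Longrightarrow> P x"
    and closed: "\<And>n f xs. (n, f) \<in> F \<Longrightarrow> length xs = n \<Longrightarrow> set xs \<subseteq> gen F X
      \<Longrightarrow> (\<And>y. y \<in> set xs \<Longrightarrow> P y) \<Longrightarrow> P (f xs)"
  shows "P x"
proof -
  obtain n t xs where x: "x = t xs" and t: "term_op F n t" and xs: "length xs = n" "set xs \<subseteq> X"
    using assms(1) unfolding gen_def by blast
  from t have "P (t xs)"
  proof induction
    case (proj i)
    then show ?case using base xs nth_mem by blast
  next
    case (app k f ts)
    show ?case
    proof (rule closed)
      show "set (map (\<lambda>t. t xs) ts) \<subseteq> gen F X"
        using app xs unfolding gen_def by auto
    qed (use app in auto)
  qed
  then show ?thesis using x by simp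
qed

lemma gen_subset_subalgebra:
  assumes "subalgebra A F C" "X \<subseteq> C"
  shows "gen F X \<subseteq> C"
proof
  fix x assume "x \<in> gen F X"
  then show "x \<in> C"
  proof (induction rule: gen_induct)
    case (base x)
    then show ?case using assms(2) by blast
  next
    case (closed n f xs)
    then show ?case using assms(1) unfolding subalgebra_def by fast
  qed
qed

section \<open>Independent sets and bases\<close>

text \<open>A dependence of x has a finite witness, and this witness together with x lies in a
  single member of the chain. This supplies the upper bounds for Zorn's lemma.\<close>

lemma indep_chain_Union:
  assumes "subset.chain {X. indep F X} \<C>"
  shows "indep F (\<Union>\<C>)"
  unfolding indep_def
proof (intro ballI notI)
  fix x assume x: "x \<in> \<Union>\<C>" and "x \<in> gen F (\<Union>\<C> - {x})"
  then obtain Y where Y: "finite Y" "Y \<subseteq> \<Union>\<C> - {x}" "x \<in> gen F Y"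
    by (blast elim: gen_finite_subset)
  have "finite (insert x Y)" "insert x Y \<subseteq> \<Union>\<C>" "\<C> \<noteq> {}" using Y x by auto
  then obtain X where "X \<in> \<C>" "insert x Y \<subseteq> X"
    using finite_subset_Union_chain[OF _ _ _ assms] by blast
  moreover from this have "indep F X" using assms unfolding subset.chain_def by blast
  moreover have "x \<in> gen F (X - {x})"
    using gen_mono[of Y "X - {x}" F] Y \<open>insert x Y \<subseteq> X\<close> by blast
  ultimately show False unfolding indep_def by blast
qed

text \<open>If adding a made some x in X dependent, exchange would trade x for a and put a into
  \<open>gen F X\<close>.\<close>

lemma indep_insert:
  assumes "exchange_property A F" "X \<subseteq> A" "a \<in> A" "indep F X" "a \<notin> gen F X"
  shows "indep F (insert a X)"
  unfolding indep_def
proof (intro ballI notI)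
  fix x assume x: "x \<in> insert a X" "x \<in> gen F (insert a X - {x})"
  have a: "a \<notin> X" using assms(5) gen_base[of X F] by blast
  show False
  proof (cases "x = a")
    case True
    then show False using x assms(5) a by simp
  next
    case False
    then have xX: "x \<in> X" and eq: "insert a X - {x} = (X - {x}) \<union> {a}" using x by auto
    have "x \<notin> gen F (X - {x})" using assms(4) xX unfolding indep_def by blast
    moreover have "x \<in> gen F ((X - {x}) \<union> {a})" using x(2) eq by simp
    ultimately have "a \<in> gen F ((X - {x}) \<union> {x})"
      using assms(1)[unfolded exchange_property_def, rule_format, of "X - {x}" a x] assms(2,3) xX
      by blast
    moreover have "(X - {x}) \<union> {x} = X" using xX by blast
    ultimately show False using assms(5) by simp
  qed
qed

text \<open>Zorn's lemma gives a maximal independent set between Y and C. It generates C, since any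
  element of C outside its span could be added to it.\<close>

lemma indep_extends_to_basis:
  assumes "exchange_property A F" "subalgebra A F C" "Y \<subseteq> C" "indep F Y"
  obtains Z where "Y \<subseteq> Z" "basis_of F Z C"
proof -
  define S where "S = {X. Y \<subseteq> X \<and> X \<subseteq> C \<and> indep F X}"
  have "\<exists>M\<in>S. \<forall>X\<in>S. M \<subseteq> X \<longrightarrow> X = M"
  proof (rule subset_Zorn_nonempty)
    show "S \<noteq> {}" using assms unfolding S_def by blast
    fix \<C> assume ne: "\<C> \<noteq> {}" and ch: "subset.chain S \<C>"
    have "subset.chain {X. indep F X} \<C>"
      using ch unfolding subset.chain_def S_def by blast
    then have "indep F (\<Union>\<C>)" by (rule indep_chain_Union)
    then show "\<Union>\<C> \<in> S" using ne ch unfolding subset.chain_def S_def by blast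
  qed
  then obtain M where M: "M \<in> S" and max: "\<And>X. X \<in> S \<Longrightarrow> M \<subseteq> X \<Longrightarrow> X = M" by blast
  have MC: "M \<subseteq> C" and iM: "indep F M" and YM: "Y \<subseteq> M" using M unfolding S_def by auto
  have CA: "C \<subseteq> A" using assms(2) unfolding subalgebra_def by blast
  have "C \<subseteq> gen F M"
  proof (rule ccontr)
    assume "\<not> C \<subseteq> gen F M"
    then obtain c where c: "c \<in> C" "c \<notin> gen F M" by blast
    have "indep F (insert c M)"
      using indep_insert[OF assms(1)] MC CA c iM by blast
    then have "insert c M = M" using max c MC YM unfolding S_def by blast
    then have "c \<in> M" by blast
    then show False using c(2) gen_base[of M F] by blast
  qed
  then have "basis_of F M C"
    using gen_subset_subalgebra[OF assms(2) MC] iM unfolding basis_of_def by blast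
  then show thesis using that YM by blast
qed

section \<open>Endomorphisms, their images and composites\<close>

lemma endos_hom:
  assumes "\<phi> \<in> endos A F" "(n, f) \<in> F" "length xs = n" "set xs \<subseteq> A"
  shows "\<phi> (f xs) = f (map \<phi> xs)"
  using assms unfolding endos_def by fast

lemma algebra_closed:
  assumes "algebra A F" "(n, f) \<in> F" "length xs = n" "set xs \<subseteq> A"
  shows "f xs \<in> A"
  using assms unfolding algebra_def by fast

lemma subalgebra_self: "algebra A F \<Longrightarrow> subalgebra A F A"
  unfolding algebra_def subalgebra_def by simp

lemma subalgebra_image:
  assumes "algebra A F" "\<phi> \<in> endos A F"
  shows "subalgebra A F (\<phi> ` A)"
proof -
  have "f ys \<in> \<phi> ` A" if f: "(n, f) \<in> F" and ys: "length ys = n" "set ys \<subseteq> \<phi> ` A" for n f ys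
  proof -
    \<comment> \<open>All arguments are pulled back to A at once; applying f there and then \<phi>
      yields the required preimage of \<open>f ys\<close>.\<close>
    have "ys \<in> map \<phi> ` {xs. set xs \<subseteq> A}"
      using ys(2) lists_image[of \<phi> A] unfolding lists_eq_set by blast
    then obtain xs where "set xs \<subseteq> A" "ys = map \<phi> xs" by blast
    then show ?thesis
      using endos_hom[OF assms(2) f] algebra_closed[OF assms(1) f] ys(1)
      by (metis image_eqI length_map)
  qed
  moreover have "\<phi> ` A \<subseteq> A" using assms(2) unfolding endos_def by auto
  ultimately show ?thesis unfolding subalgebra_def by blast
qed

text \<open>The elements that \<phi> sends into B are closed under the operations, so it is enough
  to check generators. This bounds the image of a map known only on a basis.\<close>

lemma endos_image_gen_subset:
  assumes "\<phi> \<in> endos A F" "subalgebra A F B" "gen F Z = A" "\<phi> ` Z \<subseteq> B"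
  shows "\<phi> ` A \<subseteq> B"
proof -
  have "\<phi> x \<in> B" if "x \<in> gen F Z" for x
    using that
  proof (induction rule: gen_induct)
    case (base x)
    then show ?case using assms(4) by blast
  next
    case (closed n f xs)
    then have "\<phi> (f xs) = f (map \<phi> xs)" using endos_hom[OF assms(1)] assms(3) by blast
    moreover have "length (map \<phi> xs) = n" "set (map \<phi> xs) \<subseteq> B" using closed by auto
    ultimately show ?case using assms(2) closed(1) unfolding subalgebra_def by fastforce
  qed
  then show ?thesis using assms(3) by blast
qed

lemma endos_compose:
  assumes "algebra A F" "\<phi> \<in> endos A F" "\<psi> \<in> endos A F"
  shows "rcomp A \<phi> \<psi> \<in> endos A F"
proof -
  have A: "\<phi> x \<in> A" "\<psi> x \<in> A" if "x \<in> A" for x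
    using assms that unfolding endos_def by auto
  have "rcomp A \<phi> \<psi> (f xs) = f (map (rcomp A \<phi> \<psi>) xs)"
    if f: "(n, f) \<in> F" and xs: "length xs = n" "set xs \<subseteq> A" for n f xs
  proof -
    have "rcomp A \<phi> \<psi> (f xs) = \<psi> (f (map \<phi> xs))"
      using endos_hom[OF assms(2) f xs] algebra_closed[OF assms(1) f xs]
      by (simp add: rcomp_def compose_def)
    also have "\<dots> = f (map \<psi> (map \<phi> xs))"
      by (rule endos_hom[OF assms(3) f]) (use xs A in auto)
    also have "map \<psi> (map \<phi> xs) = map (rcomp A \<phi> \<psi>) xs"
      using xs by (auto simp: rcomp_def compose_def)
    finally show ?thesis .
  qed
  moreover have "rcomp A \<phi> \<psi> \<in> A \<rightarrow>\<^sub>E A"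
    unfolding rcomp_def compose_def using A by auto
  ultimately show ?thesis unfolding endos_def by blast
qed

lemma endos_into_compose:
  assumes "algebra A F" "B \<subseteq> A" "\<phi> \<in> endos_into A F B" "\<psi> \<in> endos_into A F B"
  shows "rcomp A \<phi> \<psi> \<in> endos_into A F B"
proof -
  have "rcomp A \<phi> \<psi> x \<in> B" if "x \<in> A" for x
    using that assms(2-4) by (auto simp: endos_into_def rcomp_def compose_eq)
  then show ?thesis
    using endos_compose[OF assms(1)] assms(3,4) by (auto simp: endos_into_def)
qed

text \<open>The easy half of the factorization criterion: points identified by the first map stay
  identified.\<close>

lemma map_ker_rcomp: "map_ker A \<phi> \<subseteq> map_ker A (rcomp A \<phi> \<psi>)"
  by (auto simp: map_ker_def rcomp_def compose_def)

section \<open>Factorization through an endomorphism and Green's relation\<close>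

lemma factor_through_endo:
  assumes alg: "independence_algebra A F" and B: "subalgebra A F B" "B \<noteq> {}"
    and \<alpha>: "\<alpha> \<in> endos_into A F B" and \<beta>: "\<beta> \<in> endos_into A F B"
    and ker: "map_ker A \<beta> \<subseteq> map_ker A \<alpha>"
  obtains \<mu> where "\<mu> \<in> endos_into A F B" "\<alpha> = rcomp A \<beta> \<mu>"
proof -
  have A: "algebra A F" and EP: "exchange_property A F" and FB: "free_basis_property A F"
    using alg unfolding independence_algebra_def by auto
  have \<alpha>': "\<alpha> \<in> endos A F" "\<alpha> ` A \<subseteq> B" and \<beta>': "\<beta> \<in> endos A F"
    using \<alpha> \<beta> unfolding endos_into_def by auto
  have BA: "B \<subseteq> A" using B unfolding subalgebra_def by blast
  have sub: "subalgebra A F (\<beta> ` A)" by (rule subalgebra_image[OF A \<beta>'])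
  have "indep F {}" unfolding indep_def by simp
  then obtain Y where Y: "basis_of F Y (\<beta> ` A)"
    using indep_extends_to_basis[OF EP sub, of "{}"] by blast
  then have iY: "indep F Y" and gY: "gen F Y = \<beta> ` A" unfolding basis_of_def by auto
  have Y\<beta>: "Y \<subseteq> \<beta> ` A" using gY gen_base[of Y F] by blast
  have \<beta>A: "\<beta> ` A \<subseteq> A" using \<beta>' unfolding endos_def by auto
  then have YA: "Y \<subseteq> A" using Y\<beta> by (rule order_trans[rotated])
  \<comment> \<open>Independence does not refer to the surrounding subalgebra, so a basis of the
    image is still independent in A.\<close>
  obtain Z where YZ: "Y \<subseteq> Z" and Z: "basis_of F Z A"
    by (rule indep_extends_to_basis[OF EP subalgebra_self[OF A] YA iY])
  obtain b where b: "b \<in> B" using B(2) by blast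
  define h where "h = inv_into A \<beta>"
  have h: "h y \<in> A" "\<beta> (h y) = y" if "y \<in> Y" for y
    using that Y\<beta> inv_into_into[of y \<beta> A] f_inv_into_f[of y \<beta> A] unfolding h_def by blast+
  \<comment> \<open>The default b is taken in B so that all values of g, and hence the image of
    \<mu>, stay in B.\<close>
  define g where "g y = (if y \<in> Y then \<alpha> (h y) else b)" for y
  have gB: "g y \<in> B" for y
    unfolding g_def using h(1) \<alpha>'(2) b by auto
  then have "g \<in> Z \<rightarrow> A" using BA by blast
  then obtain \<mu> where \<mu>: "\<mu> \<in> endos A F" "\<And>z. z \<in> Z \<Longrightarrow> \<mu> z = g z"
    using FB Z unfolding free_basis_property_def by blast
  have "\<mu> ` A \<subseteq> B"
  proof (rule endos_image_gen_subset[OF \<mu>(1) B(1)])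
    show "gen F Z = A" using Z unfolding basis_of_def by blast
    show "\<mu> ` Z \<subseteq> B" using \<mu>(2) gB by auto
  qed
  then have \<mu>B: "\<mu> \<in> endos_into A F B" using \<mu>(1) unfolding endos_into_def by blast
  \<comment> \<open>Every z in the image of \<beta> has at least one preimage on which \<alpha>
    agrees with \<mu> after \<beta>. On Y it is the chosen one; otherwise f is applied to such
    preimages of the arguments. The kernel inclusion enters only afterwards.\<close>
  have lift: "\<exists>w\<in>A. \<beta> w = z \<and> \<alpha> w = \<mu> z" if "z \<in> gen F Y" for z
    using that
  proof (induction rule: gen_induct)
    case (base y)
    then have "\<mu> y = \<alpha> (h y)" using \<mu>(2) YZ unfolding g_def by auto
    then show ?case using h[OF base] by metis
  next
    case (closed n f zs)
    obtain k where k: "\<And>z. z \<in> set zs \<Longrightarrow> k z \<in> A \<and> \<beta> (k z) = z \<and> \<alpha> (k z) = \<mu> z"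
      using closed(4) by metis
    have ws: "length (map k zs) = n" "set (map k zs) \<subseteq> A" using k closed(2) by auto
    have zA: "set zs \<subseteq> A"
      using closed(3) gY \<beta>A by simp
    have "\<beta> (f (map k zs)) = f (map \<beta> (map k zs))"
      by (rule endos_hom[OF \<beta>' closed(1) ws])
    also have "map \<beta> (map k zs) = zs" using k by (simp add: map_idI)
    finally have 1: "\<beta> (f (map k zs)) = f zs" .
    have "\<alpha> (f (map k zs)) = f (map \<alpha> (map k zs))"
      by (rule endos_hom[OF \<alpha>'(1) closed(1) ws])
    also have "map \<alpha> (map k zs) = map \<mu> zs" using k by simp
    also have "f (map \<mu> zs) = \<mu> (f zs)"
      by (rule endos_hom[OF \<mu>(1) closed(1,2) zA, symmetric])
    finally have "\<alpha> (f (map k zs)) = \<mu> (f zs)" .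
    then show ?case using 1 algebra_closed[OF A closed(1) ws] by blast
  qed
  have "\<alpha> x = \<mu> (\<beta> x)" if x: "x \<in> A" for x
  proof -
    \<comment> \<open>This w may differ from x, but both have the same \<beta>-value, so the kernel
      inclusion gives them the same \<alpha>-value.\<close>
    obtain w where w: "w \<in> A" "\<beta> w = \<beta> x" "\<alpha> w = \<mu> (\<beta> x)"
      using lift[of "\<beta> x"] gY x by blast
    then have "(w, x) \<in> map_ker A \<alpha>" using ker x unfolding map_ker_def by blast
    then show ?thesis using w(3) unfolding map_ker_def by simp
  qed
  \<comment> \<open>Extensionality lifts agreement on A to equality of HOL functions.\<close>
  moreover have "\<alpha> x = undefined" if "x \<notin> A" for x
    using \<alpha>'(1) that unfolding endos_def by (auto simp: PiE_def extensional_def)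
  ultimately have "\<alpha> = rcomp A \<beta> \<mu>"
    unfolding rcomp_def compose_def by auto
  then show thesis using that \<mu>B by blast
qed

theorem proposition4p1:
  fixes A B :: "'a set" and F :: "'a ops" and \<alpha> \<beta> :: "'a \<Rightarrow> 'a"
  assumes "independence_algebra A F"
    and "subalgebra A F B" and "B \<noteq> {}" and "B \<noteq> A"
    and "ctwo \<le>o alg_dim F B \<or> (gen F {} \<noteq> {} \<and> alg_dim F B =o cone)"
    and "\<alpha> \<in> endos_into A F B" and "\<beta> \<in> endos_into A F B"
  shows "((\<exists>\<mu>\<in>endos_into A F B. \<alpha> = rcomp A \<beta> \<mu>) \<longleftrightarrow> map_ker A \<beta> \<subseteq> map_ker A \<alpha>) \<and>
         (green_R (endos_into A F B) (rcomp A) \<alpha> \<beta> \<longleftrightarrow> map_ker A \<alpha> = map_ker A \<beta>)"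
proof -
  let ?S = "endos_into A F B"
  let ?I = "principal_right_ideal ?S (rcomp A)"
  have A: "algebra A F" using assms(1) unfolding independence_algebra_def by blast
  have BA: "B \<subseteq> A" using assms(2) unfolding subalgebra_def by blast
  have factor: "(\<exists>\<mu>\<in>?S. \<phi> = rcomp A \<psi> \<mu>) \<longleftrightarrow> map_ker A \<psi> \<subseteq> map_ker A \<phi>"
    if "\<phi> \<in> ?S" "\<psi> \<in> ?S" for \<phi> \<psi>
    using factor_through_endo[OF assms(1-3) that] map_ker_rcomp by metis
  \<comment> \<open>The generator itself also belongs to the ideal; for it the kernel inclusion is
    reflexivity.\<close>
  have mem: "\<phi> \<in> ?I \<psi> \<longleftrightarrow> map_ker A \<psi> \<subseteq> map_ker A \<phi>" if "\<phi> \<in> ?S" "\<psi> \<in> ?S" for \<phi> \<psi>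
    using factor[OF that] unfolding principal_right_ideal_def by auto
  have "?I \<psi> \<subseteq> ?S" if "\<psi> \<in> ?S" for \<psi>
    using that endos_into_compose[OF A BA] unfolding principal_right_ideal_def by blast
  \<comment> \<open>The kernel of the generator thus determines the ideal. Conversely, equal ideals
    contain each other's generators, which gives both kernel inclusions.\<close>
  then have "?I \<psi> = {\<phi> \<in> ?S. map_ker A \<psi> \<subseteq> map_ker A \<phi>}" if "\<psi> \<in> ?S" for \<psi>
    using mem that by blast
  then have "green_R ?S (rcomp A) \<alpha> \<beta> \<longleftrightarrow> map_ker A \<alpha> = map_ker A \<beta>"
    using assms(6,7) unfolding green_R_def by blast
  then show ?thesis using factor assms(6,7) by blast
qed

end
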